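(* Let $X$ be a finite set with $|X|=n$, and let $a\in\mathcal T_X$ be an idempotent with $r=\operatorname{rank}(a)$. If $1<r<n$, then $\operatorname{rank}(\operatorname{Reg}(\mathcal T_X^a))=r^{n-r}+1$.
   Context: $\mathcal T_X$ is the full transformation semigroup of all maps $X\to X$ under composition; maps are written on the right and composed from left to right; for $f\in\mathcal T_X$, $\operatorname{rank}(f)=|\operatorname{im}(f)|$. The variant $\mathcal T_X^a$ is the semigroup with underlying set $\mathcal T_X$ and operation $f\star g=fag$; $\operatorname{Reg}(\mathcal T_X^a)=\{f\in\mathcal T_X:\operatorname{rank}(afa)=\operatorname{rank}(f)\}$ is its set of regular elements, which is a subsemigroup of $\mathcal T_X^a$ (with operation $\star$). For a semigroup $S$, $\operatorname{rank}(S)$ is the least cardinality of a subset generating $S$ as a semigroup. *)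

theory Defs
  imports Main
begin

text \<open>A semigroup is given by a carrier set \<open>S\<close> and a multiplication \<open>m\<close> under which \<open>S\<close>
  is closed.\<close>

inductive_set semigroup_gen :: "('s \<Rightarrow> 's \<Rightarrow> 's) \<Rightarrow> 's set \<Rightarrow> 's set"
  for m :: "'s \<Rightarrow> 's \<Rightarrow> 's" and A :: "'s set" where
  base: "x \<in> A \<Longrightarrow> x \<in> semigroup_gen m A"
| mult: "x \<in> semigroup_gen m A \<Longrightarrow> y \<in> semigroup_gen m A \<Longrightarrow> m x y \<in> semigroup_gen m A"

text \<open>Only meaningful for finitely generated semigroups; every finite semigroup is one.\<close>

definition semigroup_rank :: "('s \<Rightarrow> 's \<Rightarrow> 's) \<Rightarrow> 's set \<Rightarrow> nat" where
  "semigroup_rank m S =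
     (LEAST k. \<exists>A. A \<subseteq> S \<and> finite A \<and> card A = k \<and> semigroup_gen m A = S)"

definition regular_elements :: "('s \<Rightarrow> 's \<Rightarrow> 's) \<Rightarrow> 's set \<Rightarrow> 's set" where
  "regular_elements m S = {x \<in> S. \<exists>y\<in>S. m (m x y) x = x}"

definition map_rank :: "('a \<Rightarrow> 'a) \<Rightarrow> nat" where
  "map_rank f = card (range f)"

text \<open>Maps act on the right, so the product \<open>fag\<close> applies \<open>f\<close> first, then \<open>a\<close>, then \<open>g\<close>.
  The underlying set of the variant is the set of all maps on the type \<open>'a\<close>.\<close>

definition variant_mult :: "('a \<Rightarrow> 'a) \<Rightarrow> ('a \<Rightarrow> 'a) \<Rightarrow> ('a \<Rightarrow> 'a) \<Rightarrow> ('a \<Rightarrow> 'a)" where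
  "variant_mult a f g = g \<circ> a \<circ> f"

definition Reg_variant :: "('a \<Rightarrow> 'a) \<Rightarrow> ('a \<Rightarrow> 'a) set" where
  "Reg_variant a = regular_elements (variant_mult a) UNIV"

lemma variant_mult_assoc:
  "variant_mult a (variant_mult a f g) h = variant_mult a f (variant_mult a g h)"
  by (simp add: variant_mult_def comp_assoc)

lemma map_rank_sandwich_eq_iff:
  fixes a f :: "'a::finite \<Rightarrow> 'a"
  shows "map_rank (a \<circ> f \<circ> a) = map_rank f \<longleftrightarrow>
    inj_on a (range f) \<and> range (f \<circ> a) = range f"
proof
  assume eq: "map_rank (a \<circ> f \<circ> a) = map_rank f"
  have sub: "range (f \<circ> a) \<subseteq> range f" by auto
  have im: "range (a \<circ> f \<circ> a) = a ` range (f \<circ> a)" by auto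
  have "card (a ` range (f \<circ> a)) \<le> card (range (f \<circ> a))"
    by (rule card_image_le) simp
  with eq im have "card (range f) \<le> card (range (f \<circ> a))"
    by (simp add: map_rank_def)
  then have r: "range (f \<circ> a) = range f"
    using sub by (meson card_seteq finite)
  with eq im have "card (a ` range f) = card (range f)"
    by (simp add: map_rank_def)
  then have "inj_on a (range f)" by (simp add: eq_card_imp_inj_on)
  with r show "inj_on a (range f) \<and> range (f \<circ> a) = range f" by simp
next
  assume h: "inj_on a (range f) \<and> range (f \<circ> a) = range f"
  have "range (a \<circ> f \<circ> a) = a ` range (f \<circ> a)" by auto
  with h show "map_rank (a \<circ> f \<circ> a) = map_rank f"
    by (simp add: map_rank_def card_image)
qed

text \<open>The regular elements are exactly the maps \<open>f\<close> for which \<open>afa\<close> and \<open>f\<close> have equal rank.\<close>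

lemma Reg_variant_eq:
  fixes a :: "'a::finite \<Rightarrow> 'a"
  shows "Reg_variant a = {f. map_rank (a \<circ> f \<circ> a) = map_rank f}"
proof (intro set_eqI iffI)
  fix f assume "f \<in> Reg_variant a"
  then obtain g where "f \<circ> a \<circ> (g \<circ> a \<circ> f) = f"
    by (auto simp: Reg_variant_def regular_elements_def variant_mult_def)
  then have g: "f (a (g (a (f x)))) = f x" for x
    by (metis comp_apply)
  have "inj_on a (range f)"
    by (rule inj_on_inverseI[where g = "\<lambda>z. f (a (g z))"]) (use g in auto)
  moreover have "range f \<subseteq> range (f \<circ> a)"
  proof
    fix y assume "y \<in> range f"
    then obtain x where "y = f x" by auto
    then have "y = (f \<circ> a) (g (a (f x)))" using g by simp
    then show "y \<in> range (f \<circ> a)" by blast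
  qed
  moreover have "range (f \<circ> a) \<subseteq> range f" by auto
  ultimately show "f \<in> {f. map_rank (a \<circ> f \<circ> a) = map_rank f}"
    by (simp add: map_rank_sandwich_eq_iff subset_antisym)
next
  fix f assume "f \<in> {f. map_rank (a \<circ> f \<circ> a) = map_rank f}"
  then have inj: "inj_on a (range f)" and r: "range (f \<circ> a) = range f"
    by (simp_all add: map_rank_sandwich_eq_iff)
  have "\<exists>w. f (a w) = y" if "y \<in> range f" for y
    using that r by (metis (no_types, lifting) comp_apply imageE)
  then obtain s where s: "\<And>y. y \<in> range f \<Longrightarrow> f (a (s y)) = y" by metis
  have "f (a ((s \<circ> inv_into (range f) a) (a (f x)))) = f x" for x
    using inj s by (simp add: inv_into_f_f)
  then have "f \<circ> a \<circ> ((s \<circ> inv_into (range f) a) \<circ> a \<circ> f) = f" by (simp add: fun_eq_iff)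
  then show "f \<in> Reg_variant a"
    unfolding Reg_variant_def regular_elements_def variant_mult_def by blast
qed

lemma Reg_variant_closed:
  fixes a :: "'a::finite \<Rightarrow> 'a"
  assumes "f \<in> Reg_variant a" and "g \<in> Reg_variant a"
  shows "variant_mult a f g \<in> Reg_variant a"
proof -
  have f: "range (f \<circ> a) = range f" and g: "inj_on a (range g)"
    using assms by (simp_all add: Reg_variant_eq map_rank_sandwich_eq_iff)
  have "range (g \<circ> a \<circ> f) \<subseteq> range g" by auto
  with g have "inj_on a (range (g \<circ> a \<circ> f))" by (rule inj_on_subset)
  moreover have "range (g \<circ> a \<circ> f \<circ> a) = range (g \<circ> a \<circ> f)"
    using f by (metis comp_assoc image_comp)
  ultimately show ?thesis
    by (simp add: Reg_variant_eq map_rank_sandwich_eq_iff variant_mult_def)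
qed

end

theory Submission
  imports Defs "HOL-Combinatorics.Permutations" "HOL-Library.FuncSet"
begin

text \<open>Let \<open>A\<close> be the image of the idempotent \<open>a\<close>, that is, its set of fixed points. Two families
  of idempotents of rank \<open>r\<close> control the regular elements: the retractions \<open>g\<close> of \<open>X\<close> onto \<open>A\<close>,
  of which there are \<open>r ^ (n - r)\<close>, and the maps \<open>p\<close> that have the same kernel as \<open>a\<close> and send
  each kernel class to one of its own points. A map \<open>f\<close> is regular iff \<open>f = p \<circ> f \<circ> g\<close> for some
  such \<open>p\<close> and \<open>g\<close> (\<open>Reg_variant_iff\<close>), and then \<open>f\<close> is determined by \<open>p\<close>, \<open>g\<close> and the
  self-map of \<open>A\<close> that \<open>a \<circ> f\<close> induces. Passing to the induced self-map is a homomorphism from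
  the regular elements onto the full transformation semigroup of \<open>A\<close>.

  \<^emph>\<open>Lower bound\<close> (\<open>card_generating_set_ge\<close>). The regular elements of rank \<open>r\<close> are those injective
  on \<open>A\<close>. If a product has rank \<open>r\<close>, then so has its first factor, which moreover has the same
  kernel as the product. So a generating set contains an element of rank \<open>r\<close> for each of the
  \<open>r ^ (n - r)\<close> kernels of retractions, and it needs one more element of smaller rank, because
  elements of rank \<open>r\<close> only generate elements of rank \<open>r\<close>.

  \<^emph>\<open>Upper bound\<close> (\<open>generate_all\<close>). There are at most as many maps \<open>p\<close> as retractions, so some map
  \<open>\<theta>\<close> sends the set of retractions onto the set of the \<open>p\<close>. Fix \<open>i \<in> A\<close> and \<open>z \<notin> A\<close>, and assign to
  each retraction \<open>g\<close> the generator \<open>\<theta> g \<circ> (i, g z) \<circ> g\<close>, where \<open>(i, g z)\<close> is a transposition,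
  or the identity if \<open>g z = i\<close>. The maps induced on \<open>A\<close> by these generators include all
  transpositions that move \<open>i\<close>, so together with one map of rank \<open>r - 1\<close> they generate all
  self-maps of \<open>A\<close>. Multiplying on both sides by suitable generators of rank \<open>r\<close> then
  yields every \<open>p \<circ> \<sigma> \<circ> g\<close>, hence every regular element.\<close>

section \<open>Retractions and sections of an idempotent\<close>

locale idempotent_map =
  fixes a :: "'a::finite \<Rightarrow> 'a"
  assumes idem: "a (a x) = a x"
begin

text \<open>The image of \<open>a\<close>, written as its set of fixed points.\<close>

abbreviation A :: "'a set" where
  "A \<equiv> {x. a x = x}"

lemma range_eq: "range a = A"
  using idem by (auto intro: range_eqI[OF sym])

text \<open>The idempotent maps with image \<open>A\<close>.\<close>

definition retractions :: "('a \<Rightarrow> 'a) set" where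
  "retractions = {g. (\<forall>x. g x \<in> A) \<and> (\<forall>x\<in>A. g x = x)}"

text \<open>The idempotent maps with the same kernel as \<open>a\<close>. Such a map stands for the section of \<open>a\<close>
  on \<open>A\<close>, equivalently for the transversal of the kernel of \<open>a\<close>, that it determines.\<close>

definition sections :: "('a \<Rightarrow> 'a) set" where
  "sections = {p. \<forall>x. p (a x) = p x \<and> a (p x) = a x}"

lemma retractionsD:
  assumes "g \<in> retractions"
  shows "a (g x) = g x" and "a x = x \<Longrightarrow> g x = x"
  using assms by (auto simp: retractions_def)

lemma sectionsD:
  assumes "p \<in> sections"
  shows "p (a x) = p x" and "a (p x) = a x"
  using assms by (auto simp: sections_def)

lemma a_in_retractions: "a \<in> retractions"
  by (simp add: retractions_def idem)

lemma a_in_sections: "a \<in> sections"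
  by (simp add: sections_def idem)

lemma card_retractions:
  "card retractions = card A ^ (card (UNIV :: 'a set) - card A)"
proof -
  have "bij_betw (\<lambda>g. restrict g (- A)) retractions (PiE (- A) (\<lambda>_. A))"
  proof (rule bij_betwI[where g = "\<lambda>h x. if x \<in> A then x else h x"])
    show "(\<lambda>g. restrict g (- A)) \<in> retractions \<rightarrow> PiE (- A) (\<lambda>_. A)"
      by (simp add: Pi_iff retractions_def)
    show "(\<lambda>h x. if x \<in> A then x else h x) \<in> PiE (- A) (\<lambda>_. A) \<rightarrow> retractions"
      by (auto simp: PiE_iff retractions_def)
  next
    fix g assume "g \<in> retractions"
    then show "(\<lambda>x. if x \<in> A then x else restrict g (- A) x) = g"
      by (simp add: fun_eq_iff retractionsD(2))
  next
    fix h assume h: "h \<in> PiE (- A) (\<lambda>_. A)"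
    show "restrict (\<lambda>x. if x \<in> A then x else h x) (- A) = h"
      by (rule ext) (simp add: PiE_arb[OF h])
  qed
  then have "card retractions = card (PiE (- A) (\<lambda>_. A))"
    by (rule bij_betw_same_card)
  also have "\<dots> = card A ^ card (- A)"
    by (simp add: card_PiE)
  also have "card (- A) = card (UNIV :: 'a set) - card A"
    by (simp add: Compl_eq_Diff_UNIV card_Diff_subset)
  finally show ?thesis .
qed

lemma Reg_variantD:
  assumes "f \<in> Reg_variant a"
  shows "a (f x) = a (f y) \<Longrightarrow> f x = f y" and "\<exists>y\<in>A. f y = f x"
proof -
  have inj: "inj_on a (range f)" and r: "range (f \<circ> a) = range f"
    using assms by (simp_all add: Reg_variant_eq map_rank_sandwich_eq_iff)
  show "a (f x) = a (f y) \<Longrightarrow> f x = f y"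
    using inj by (auto dest: inj_onD)
  have "f x \<in> range (f \<circ> a)" using r by blast
  then obtain y where "f (a y) = f x" by auto
  then show "\<exists>y\<in>A. f y = f x" by (intro bexI[of _ "a y"]) (simp_all add: idem)
qed

lemma Reg_variantI:
  assumes "\<And>x y. a (f x) = a (f y) \<Longrightarrow> f x = f y" and "\<And>x. \<exists>y\<in>A. f y = f x"
  shows "f \<in> Reg_variant a"
proof -
  have "inj_on a (range f)" using assms(1) by (auto intro!: inj_onI)
  moreover have "range f \<subseteq> range (f \<circ> a)"
  proof
    fix z assume "z \<in> range f"
    then obtain y where "y \<in> A" "f y = z" using assms(2) by blast
    then have "(f \<circ> a) y = z" by simp
    then show "z \<in> range (f \<circ> a)" by blast
  qed
  ultimately show ?thesis
    by (auto simp: Reg_variant_eq map_rank_sandwich_eq_iff)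
qed

lemma sandwich_in_Reg:
  assumes "p \<in> sections" "g \<in> retractions"
  shows "p \<circ> f \<circ> g \<in> Reg_variant a"
proof (rule Reg_variantI)
  fix x y assume "a ((p \<circ> f \<circ> g) x) = a ((p \<circ> f \<circ> g) y)"
  then show "(p \<circ> f \<circ> g) x = (p \<circ> f \<circ> g) y"
    using sectionsD[OF assms(1)] by (metis comp_apply)
next
  fix x
  show "\<exists>y\<in>A. (p \<circ> f \<circ> g) y = (p \<circ> f \<circ> g) x"
    using retractionsD[OF assms(2)] by (intro bexI[of _ "g x"]) auto
qed

lemma Reg_variant_iff:
  "f \<in> Reg_variant a \<longleftrightarrow> (\<exists>p\<in>sections. \<exists>g\<in>retractions. f = p \<circ> f \<circ> g)"
proof
  assume f: "f \<in> Reg_variant a"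
  obtain c where c: "\<And>x. a (c x) = c x" "\<And>x. f (c x) = f x"
    using Reg_variantD(2)[OF f] unfolding Bex_def mem_Collect_eq by metis
  define g where "g x = (if a x = x then x else c x)" for x
  have g: "g \<in> retractions" and fg: "f (g x) = f x" for x
    using c by (auto simp: retractions_def g_def)
  \<comment> \<open>The section takes its value in the range of \<open>f\<close> whenever the kernel class meets that range.\<close>
  define p where "p x = (if \<exists>y. a (f y) = a x then f (SOME y. a (f y) = a x) else a x)" for x
  have some: "a (f (SOME y. a (f y) = a x)) = a x" if "\<exists>y. a (f y) = a x" for x
    using that by (rule someI_ex)
  have p: "p \<in> sections"
    using some by (auto simp: sections_def p_def idem)
  have pf: "p (f x) = f x" for x
  proof -
    have ex: "\<exists>y. a (f y) = a (f x)" by blast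
    show ?thesis
      using Reg_variantD(1)[OF f some[OF ex]] ex by (simp add: p_def)
  qed
  have "f = p \<circ> f \<circ> g" by (simp add: fun_eq_iff fg pf)
  with p g show "\<exists>p\<in>sections. \<exists>g\<in>retractions. f = p \<circ> f \<circ> g" by blast
next
  assume "\<exists>p\<in>sections. \<exists>g\<in>retractions. f = p \<circ> f \<circ> g"
  then obtain p g where "p \<in> sections" "g \<in> retractions" and eq: "f = p \<circ> f \<circ> g"
    by blast
  then show "f \<in> Reg_variant a" by (subst eq) (rule sandwich_in_Reg)
qed

lemma retractions_subset_Reg: "retractions \<subseteq> Reg_variant a"
proof
  fix g assume g: "g \<in> retractions"
  then have "g = a \<circ> g \<circ> g" by (simp add: fun_eq_iff retractionsD)
  with g show "g \<in> Reg_variant a"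
    using Reg_variant_iff a_in_sections by blast
qed

lemma semigroup_gen_subset_Reg:
  assumes "B \<subseteq> Reg_variant a"
  shows "semigroup_gen (variant_mult a) B \<subseteq> Reg_variant a"
proof
  fix f assume "f \<in> semigroup_gen (variant_mult a) B"
  then show "f \<in> Reg_variant a"
    using assms by induction (auto intro: Reg_variant_closed)
qed

end

text \<open>The case of interest: the idempotent is neither constant nor the identity.\<close>

locale intermediate_idempotent = idempotent_map +
  assumes rank_gt_1: "1 < card A" and not_id: "A \<noteq> UNIV"
begin

lemma obtain_two_fixed_points:
  obtains i j where "i \<in> A" "j \<in> A" "i \<noteq> j"
proof -
  have "\<exists>i\<in>A. \<exists>j\<in>A. i \<noteq> j"
  proof (rule ccontr)
    assume "\<not> ?thesis"
    then have "card A \<le> 1" by (subst card_le_Suc0_iff_eq[unfolded One_nat_def[symmetric]]) auto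
    with rank_gt_1 show False by simp
  qed
  with that show ?thesis by blast
qed

section \<open>The lower bound\<close>

text \<open>For regular \<open>f\<close>, injectivity on \<open>A\<close> says that \<open>f\<close> has the maximal rank \<open>card A\<close>. The \<open>b\<close>
  found below is the first factor of \<open>f\<close> in a factorization over \<open>B\<close>.\<close>

lemma first_factor_kernel:
  assumes B: "B \<subseteq> Reg_variant a"
    and "f \<in> semigroup_gen (variant_mult a) B" and "inj_on f A"
  shows "\<exists>b\<in>B. inj_on b A \<and> (\<forall>x y. f x = f y \<longrightarrow> b x = b y)"
  using assms(2,3)
proof induction
  case (base f)
  then show ?case by blast
next
  case (mult f h)
  have f: "f \<in> Reg_variant a"
    using mult.hyps semigroup_gen_subset_Reg[OF B] by blast
  have inj: "x = y" if "x \<in> A" "y \<in> A" "h (a (f x)) = h (a (f y))" for x y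
    using mult.prems that by (auto simp: variant_mult_def inj_on_def)
  have "inj_on f A"
    by (rule inj_onI, rule inj) simp_all
  then obtain b where b: "b \<in> B" "inj_on b A" "\<And>x y. f x = f y \<Longrightarrow> b x = b y"
    using mult.IH by blast
  have "b x = b y" if eq: "h (a (f x)) = h (a (f y))" for x y
  proof -
    \<comment> \<open>Both values of \<open>f\<close> are attained on \<open>A\<close>, where the product is injective.\<close>
    obtain x' y' where "x' \<in> A" "f x' = f x" "y' \<in> A" "f y' = f y"
      using Reg_variantD(2)[OF f] by metis
    then have "f x = f y" using inj[of x' y'] eq by simp
    then show ?thesis by (rule b(3))
  qed
  then show ?case
    unfolding variant_mult_def comp_apply using b(1,2) by blast
qed

lemma semigroup_gen_inj_on:
  assumes B: "B \<subseteq> Reg_variant a" and inj: "\<And>b. b \<in> B \<Longrightarrow> inj_on b A"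
    and "f \<in> semigroup_gen (variant_mult a) B"
  shows "inj_on f A"
  using assms(3)
proof induction
  case (base f)
  then show ?case by (rule inj)
next
  case (mult f h)
  have f: "f \<in> Reg_variant a"
    using mult.hyps semigroup_gen_subset_Reg[OF B] by blast
  show ?case
  proof (rule inj_onI)
    fix x y assume xy: "x \<in> A" "y \<in> A" and "variant_mult a f h x = variant_mult a f h y"
    then have "h (a (f x)) = h (a (f y))" by (simp add: variant_mult_def)
    then have "a (f x) = a (f y)"
      using mult.IH(2) by (auto simp: idem dest: inj_onD)
    then show "x = y"
      using Reg_variantD(1)[OF f] inj_onD[OF mult.IH(1)] xy by blast
  qed
qed

text \<open>A regular element that identifies two points \<open>i\<close> and \<open>j\<close> of \<open>A\<close> and fixes all
  other points of \<open>A\<close>.\<close>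

definition collapse :: "'a \<Rightarrow> 'a \<Rightarrow> 'a \<Rightarrow> 'a" where
  "collapse i j = (id(j := i)) \<circ> a"

lemma collapse_in_Reg:
  assumes "i \<in> A"
  shows "collapse i j \<in> Reg_variant a"
proof -
  have "collapse i j = a \<circ> collapse i j \<circ> a"
    using assms by (auto simp: collapse_def fun_eq_iff idem)
  then show ?thesis
    using Reg_variant_iff a_in_sections a_in_retractions by blast
qed

lemma card_generating_set_ge:
  assumes gen: "semigroup_gen (variant_mult a) B = Reg_variant a"
  shows "card retractions + 1 \<le> card B"
proof -
  have B: "B \<subseteq> Reg_variant a"
    unfolding gen[symmetric] by (auto intro: semigroup_gen.base)
  have "\<exists>b\<in>B. inj_on b A \<and> (\<forall>x. b (g x) = b x)" if g: "g \<in> retractions" for g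
  proof -
    have "g \<in> semigroup_gen (variant_mult a) B"
      using g gen retractions_subset_Reg by blast
    moreover have "inj_on g A"
      using retractionsD(2)[OF g] by (auto intro: inj_onI)
    ultimately obtain b where "b \<in> B" "inj_on b A" "\<And>x y. g x = g y \<Longrightarrow> b x = b y"
      using first_factor_kernel[OF B] by blast
    moreover have "g (g x) = g x" for x
      using retractionsD[OF g] by simp
    ultimately show ?thesis by blast
  qed
  then obtain \<beta> where \<beta>: "\<And>g. g \<in> retractions \<Longrightarrow> \<beta> g \<in> B"
      "\<And>g. g \<in> retractions \<Longrightarrow> inj_on (\<beta> g) A"
      "\<And>g x. g \<in> retractions \<Longrightarrow> \<beta> g (g x) = \<beta> g x"
    by metis
  have "inj_on \<beta> retractions"
  proof (rule inj_onI, rule ext)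
    fix g h x assume gh: "g \<in> retractions" "h \<in> retractions" "\<beta> g = \<beta> h"
    have "\<beta> g (g x) = \<beta> g (h x)"
      using \<beta>(3)[OF gh(1)] \<beta>(3)[OF gh(2)] gh(3) by simp
    then show "g x = h x"
      using \<beta>(2)[OF gh(1)] retractionsD(1) gh(1,2) by (auto dest: inj_onD)
  qed
  then have card_eq: "card (\<beta> ` retractions) = card retractions"
    by (rule card_image)
  obtain i j where ij: "i \<in> A" "j \<in> A" "i \<noteq> j"
    by (rule obtain_two_fixed_points)
  have "\<not> inj_on (collapse i j) A"
    using ij by (auto simp: collapse_def inj_on_def)
  then obtain b where b: "b \<in> B" "\<not> inj_on b A"
    using semigroup_gen_inj_on[OF B] collapse_in_Reg[OF ij(1)] gen by blast
  have "b \<notin> \<beta> ` retractions" using b(2) \<beta>(2) by auto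
  then have "card retractions + 1 = card (insert b (\<beta> ` retractions))"
    by (simp add: card_eq)
  also have "\<dots> \<le> card B"
    using b(1) \<beta>(1) by (intro card_mono) auto
  finally show ?thesis .
qed

section \<open>The upper bound\<close>

text \<open>There are no more sections than retractions: send a section \<open>p\<close> to the retraction that
  agrees with \<open>a\<close> except at the values of \<open>p\<close> outside \<open>A\<close>, where it takes some other value in
  \<open>A\<close>. The exceptional points determine \<open>p\<close>.\<close>

lemma retractions_onto_sections:
  obtains \<theta> where "\<theta> ` retractions = sections"
proof -
  obtain i j where "i \<in> A" "j \<in> A" "i \<noteq> j"
    by (rule obtain_two_fixed_points)
  then have "\<exists>y. a y = y \<and> y \<noteq> x" for x by (cases "x = i") auto
  then obtain other where other: "\<And>x. a (other x) = other x" "\<And>x. other x \<noteq> x"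
    by metis
  define \<psi> where
    "\<psi> p x = (if a x \<noteq> x \<and> p x = x then other (a x) else a x)" for p :: "'a \<Rightarrow> 'a" and x
  have "\<psi> p \<in> retractions" for p
    using other(1) by (auto simp: \<psi>_def retractions_def idem)
  moreover have "inj_on \<psi> sections"
  proof (rule inj_onI, rule ext)
    fix p q x assume p: "p \<in> sections" and q: "q \<in> sections" and eq: "\<psi> p = \<psi> q"
    have *: "a y \<noteq> y \<and> p y = y \<longleftrightarrow> a y \<noteq> y \<and> q y = y" for y
      using fun_cong[OF eq, of y] other(2)[of "a y"] by (auto simp: \<psi>_def split: if_splits)
    have pp: "p (p x) = p x" "q (p x) = q x" and qq: "q (q x) = q x" "p (q x) = p x"
      using sectionsD[OF p] sectionsD[OF q] by metis+
    show "p x = q x"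
    proof (cases "a (p x) = p x \<and> a (q x) = q x")
      case True
      then show ?thesis using sectionsD(2)[OF p] sectionsD(2)[OF q] by metis
    next
      case False
      then show ?thesis using *[of "p x"] *[of "q x"] pp qq by auto
    qed
  qed
  moreover have "sections \<noteq> {}" using a_in_sections by blast
  ultimately have "\<exists>\<theta>. \<theta> ` retractions = sections"
    using inj_on_iff_surj[of sections retractions] by blast
  with that show ?thesis by blast
qed

text \<open>The self-maps of \<open>A\<close> that are induced by a member of \<open>W\<close>. Only the values of \<open>\<sigma>\<close> on \<open>A\<close>
  matter.\<close>

definition induced :: "('a \<Rightarrow> 'a) set \<Rightarrow> ('a \<Rightarrow> 'a) \<Rightarrow> bool" where
  "induced W \<sigma> \<longleftrightarrow> (\<exists>w\<in>W. \<forall>x\<in>A. a (w x) = \<sigma> x)"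

lemma induced_cong:
  assumes "\<And>x. x \<in> A \<Longrightarrow> \<sigma> x = \<tau> x"
  shows "induced W \<sigma> \<longleftrightarrow> induced W \<tau>"
  using assms by (simp add: induced_def)

lemma induced_comp:
  assumes "induced (semigroup_gen (variant_mult a) B) \<sigma>"
    and "induced (semigroup_gen (variant_mult a) B) \<tau>"
  shows "induced (semigroup_gen (variant_mult a) B) (\<tau> \<circ> \<sigma>)"
proof -
  obtain v where v: "v \<in> semigroup_gen (variant_mult a) B" "\<And>x. x \<in> A \<Longrightarrow> a (v x) = \<sigma> x"
    using assms(1) by (auto simp: induced_def)
  obtain w where w: "w \<in> semigroup_gen (variant_mult a) B" "\<And>x. x \<in> A \<Longrightarrow> a (w x) = \<tau> x"
    using assms(2) by (auto simp: induced_def)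
  have "a (variant_mult a v w x) = (\<tau> \<circ> \<sigma>) x" if "x \<in> A" for x
    using w(2)[of "a (v x)"] v(2)[OF that, symmetric] by (simp add: variant_mult_def idem)
  then show ?thesis
    using semigroup_gen.mult[OF v(1) w(1)] by (auto simp: induced_def)
qed

lemma induced_permutation:
  assumes i: "i \<in> A"
    and star: "\<And>c. c \<in> A \<Longrightarrow> induced (semigroup_gen (variant_mult a) B) (transpose i c)"
    and p: "p permutes A"
  shows "induced (semigroup_gen (variant_mult a) B) p"
proof -
  have transp: "induced (semigroup_gen (variant_mult a) B) (transpose c d)"
    if "c \<in> A" "d \<in> A" "c \<noteq> d" for c d
  proof (cases "c = i \<or> d = i")
    case True
    then show ?thesis using star that by (auto simp: transpose_commute)
  next
    case False
    then have "transpose c d = transpose i c \<circ> (transpose i d \<circ> transpose i c)"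
      using that by (auto simp: fun_eq_iff transpose_def)
    then show ?thesis using induced_comp star that by metis
  qed
  show ?thesis
  proof (rule permutes_induct[OF p])
    show "finite A" by simp
  next
    show "induced (semigroup_gen (variant_mult a) B) id"
      using star[OF i] by simp
  next
    fix c d q
    assume "c \<in> A" "d \<in> A" "c \<noteq> d" "induced (semigroup_gen (variant_mult a) B) q"
    then show "induced (semigroup_gen (variant_mult a) B) (transpose c d \<circ> q)"
      using transp induced_comp by blast
  qed
qed

lemma induced_all:
  assumes i: "i \<in> A" and j: "j \<in> A" and ij: "i \<noteq> j"
    and star: "\<And>c. c \<in> A \<Longrightarrow> induced (semigroup_gen (variant_mult a) B) (transpose i c)"
    and merge: "induced (semigroup_gen (variant_mult a) B) (id(j := i))"
    and "\<sigma> ` A \<subseteq> A"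
  shows "induced (semigroup_gen (variant_mult a) B) \<sigma>"
  using assms(6)
proof (induction "card (A - \<sigma> ` A)" arbitrary: \<sigma> rule: less_induct)
  case less
  let ?I = "induced (semigroup_gen (variant_mult a) B)"
  have perm: "?I q" if "q permutes A" for q
    using induced_permutation[OF i star that] .
  show ?case
  proof (cases "inj_on \<sigma> A")
    case True
    define q where "q x = (if x \<in> A then \<sigma> x else x)" for x
    have "\<sigma> ` A = A"
      using True less.prems by (intro endo_inj_surj) auto
    then have "bij_betw \<sigma> A A" using True by (simp add: bij_betw_def)
    then have "bij_betw q A A"
      by (subst bij_betw_cong[where g = \<sigma>]) (auto simp: q_def)
    then have "q permutes A"
      by (rule bij_imp_permutes) (simp add: q_def)
    then have "?I q" by (rule perm)
    then show ?thesis
      by (subst induced_cong[where \<tau> = q]) (auto simp: q_def)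
  next
    case False
    then obtain c d where cd: "c \<in> A" "d \<in> A" "c \<noteq> d" "\<sigma> c = \<sigma> d"
      by (auto simp: inj_on_def)
    have "\<sigma> ` A \<noteq> A"
      using False by (metis finite eq_card_imp_inj_on)
    then obtain y where y: "y \<in> A" "y \<notin> \<sigma> ` A"
      using less.prems by blast
    \<comment> \<open>Moving the image of \<open>c\<close> to the missing point \<open>y\<close> enlarges the image, and \<open>\<sigma>\<close> is recovered
      by first merging \<open>c\<close> into \<open>d\<close>.\<close>
    have "(\<sigma>(c := y)) ` A = insert y (\<sigma> ` A)"
    proof -
      have "\<sigma> ` A = \<sigma> ` (A - {c})" using cd by auto
      moreover have "(\<sigma>(c := y)) ` A = insert y (\<sigma> ` (A - {c}))" using cd(1) by auto
      ultimately show ?thesis by simp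
    qed
    then have "A - (\<sigma>(c := y)) ` A \<subset> A - \<sigma> ` A" and sub: "(\<sigma>(c := y)) ` A \<subseteq> A"
      using y less.prems by auto
    then have "card (A - (\<sigma>(c := y)) ` A) < card (A - \<sigma> ` A)"
      by (intro psubset_card_mono) auto
    then have up: "?I (\<sigma>(c := y))"
      using less.hyps sub by blast
    \<comment> \<open>A permutation that sends \<open>c\<close> to \<open>j\<close> and \<open>d\<close> to \<open>i\<close>.\<close>
    define q where "q = transpose (transpose c j d) i \<circ> transpose c j"
    have q: "q permutes A"
      unfolding q_def using cd i j
      by (intro permutes_compose permutes_swap_id) (auto simp: transpose_def)
    have qc: "q c = j" and qd: "q d = i"
      using cd ij by (auto simp: q_def transpose_def)
    have "(inv q \<circ> (id(j := i) \<circ> q)) x = (id(c := d)) x" for x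
    proof (cases "x = c")
      case True
      then show ?thesis
        using qc qd permutes_inverses(2)[OF q, of d] by simp
    next
      case False
      then have "q x \<noteq> j" using qc permutes_inj[OF q] by (auto dest: injD)
      then show ?thesis using False permutes_inverses(2)[OF q] by simp
    qed
    then have "inv q \<circ> (id(j := i) \<circ> q) = id(c := d)" by (rule ext)
    then have "?I (id(c := d))"
      using induced_comp[OF induced_comp[OF perm[OF q] merge] perm[OF permutes_inv[OF q]]]
      by simp
    then have "?I (\<sigma>(c := y) \<circ> id(c := d))"
      using up by (rule induced_comp)
    moreover have "\<sigma>(c := y) \<circ> id(c := d) = \<sigma>"
      using cd by (auto simp: fun_eq_iff)
    ultimately show ?thesis by simp
  qed
qed

lemma generate_all:
  obtains B where "B \<subseteq> Reg_variant a" "card B \<le> card retractions + 1"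
    "semigroup_gen (variant_mult a) B = Reg_variant a"
proof -
  obtain i j where ij: "i \<in> A" "j \<in> A" "i \<noteq> j"
    by (rule obtain_two_fixed_points)
  obtain z where z: "z \<notin> A" using not_id by blast
  obtain \<theta> where \<theta>: "\<theta> ` retractions = sections"
    by (rule retractions_onto_sections)
  define \<tau> where "\<tau> g = transpose i (g z)" for g
  define F where "F g = \<theta> g \<circ> \<tau> g \<circ> g" for g
  define B where "B = insert (collapse i j) (F ` retractions)"
  let ?W = "semigroup_gen (variant_mult a) B"
  have \<tau>A: "a (\<tau> g x) = \<tau> g x" if "g \<in> retractions" "a x = x" for g x
    using that ij retractionsD(1)[OF that(1)] by (auto simp: \<tau>_def transpose_def)
  have aF: "a (F g x) = \<tau> g (g x)" if "g \<in> retractions" for g x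
  proof -
    have "\<theta> g \<in> sections" using \<theta> that by blast
    then show ?thesis
      using sectionsD(2) \<tau>A[OF that] retractionsD(1)[OF that] by (simp add: F_def)
  qed
  have "F g \<in> Reg_variant a" if "g \<in> retractions" for g
    unfolding F_def using \<theta> that by (intro sandwich_in_Reg) auto
  then have BReg: "B \<subseteq> Reg_variant a"
    using collapse_in_Reg[OF ij(1)] by (auto simp: B_def)
  have FW: "F g \<in> ?W" if "g \<in> retractions" for g
    using that by (intro semigroup_gen.base) (simp add: B_def)
  have star: "induced ?W (transpose i c)" if c: "c \<in> A" for c
  proof -
    have g: "a(z := c) \<in> retractions"
      using c z by (auto simp: retractions_def idem)
    have "a (F (a(z := c)) x) = transpose i c x" if "x \<in> A" for x
      using aF[OF g] retractionsD(2)[OF g, of x] that by (simp add: \<tau>_def)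
    then show ?thesis using FW[OF g] by (auto simp: induced_def)
  qed
  have merge: "induced ?W (id(j := i))"
  proof -
    have "collapse i j \<in> ?W"
      by (intro semigroup_gen.base) (simp add: B_def)
    moreover have "a (collapse i j x) = (id(j := i)) x" if "x \<in> A" for x
      using that ij by (simp add: collapse_def)
    ultimately show ?thesis unfolding induced_def by blast
  qed
  have "Reg_variant a \<subseteq> ?W"
  proof
    fix f assume "f \<in> Reg_variant a"
    then obtain p g where p: "p \<in> sections" and g: "g \<in> retractions" and f: "f = p \<circ> f \<circ> g"
      unfolding Reg_variant_iff by (elim bexE)
    obtain h where h: "h \<in> retractions" and \<theta>h: "\<theta> h = p"
      using p unfolding \<theta>[symmetric] by (elim imageE) simp
    \<comment> \<open>The outer factors \<open>F g\<close> and \<open>F h\<close> supply the kernel and the image of \<open>f\<close>; the middle factor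
      makes up for the transpositions that they carry.\<close>
    have "(\<tau> h \<circ> a \<circ> f \<circ> \<tau> g) ` A \<subseteq> A"
      using \<tau>A[OF h] by (auto simp: idem)
    with ij star merge have "induced ?W (\<tau> h \<circ> a \<circ> f \<circ> \<tau> g)"
      by (rule induced_all)
    then obtain w where w: "w \<in> ?W" "\<And>x. x \<in> A \<Longrightarrow> a (w x) = (\<tau> h \<circ> a \<circ> f \<circ> \<tau> g) x"
      unfolding induced_def by (elim bexE) simp
    have "variant_mult a (F g) (variant_mult a w (F h)) x = f x" for x
    proof -
      have "a (w (\<tau> g (g x))) = \<tau> h (a (f (g x)))"
        using w(2) \<tau>A[OF g] retractionsD(1)[OF g] by (simp add: \<tau>_def)
      moreover have "h (\<tau> h (a y)) = \<tau> h (a y)" for y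
        using retractionsD(2)[OF h] \<tau>A[OF h] by (simp add: idem)
      ultimately have "F h (a (w (a (F g x)))) = p (a (f (g x)))"
        by (simp add: aF[OF g]) (simp add: F_def \<theta>h \<tau>_def)
      also have "\<dots> = p (f (g x))"
        by (rule sectionsD(1)[OF p])
      also have "\<dots> = f x"
        using fun_cong[OF f[symmetric], of x] by simp
      finally show ?thesis by (simp add: variant_mult_def)
    qed
    then have "f = variant_mult a (F g) (variant_mult a w (F h))" by auto
    then show "f \<in> ?W"
      using semigroup_gen.mult[OF FW[OF g] semigroup_gen.mult[OF w(1) FW[OF h]]] by simp
  qed
  then have "?W = Reg_variant a"
    using semigroup_gen_subset_Reg[OF BReg] by blast
  moreover have "card B \<le> card retractions + 1"
    unfolding B_def using card_image_le[of retractions F] by (simp add: card_insert_if)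
  ultimately show ?thesis using BReg that by blast
qed

end

section \<open>The rank of the regular elements\<close>

theorem theorem5p18:
  fixes a :: "'a::finite \<Rightarrow> 'a" and n r :: nat
  assumes "n = card (UNIV :: 'a set)"
    and "a \<circ> a = a"
    and "r = map_rank a"
    and "1 < r" and "r < n"
  shows "semigroup_rank (variant_mult a) (Reg_variant a) = r ^ (n - r) + 1"
proof -
  interpret idempotent_map a
    by unfold_locales (use assms(2) in \<open>simp add: fun_eq_iff\<close>)
  have r: "card A = r"
    using assms(3) by (simp add: map_rank_def range_eq)
  interpret intermediate_idempotent a
    by unfold_locales (use r assms in auto)
  have card_ret: "card retractions = r ^ (n - r)"
    using card_retractions r assms(1) by simp
  obtain B where B: "B \<subseteq> Reg_variant a" "card B \<le> r ^ (n - r) + 1"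
    "semigroup_gen (variant_mult a) B = Reg_variant a"
    using generate_all card_ret by metis
  have "card B = r ^ (n - r) + 1"
    using card_generating_set_ge[OF B(3)] B(2) card_ret by simp
  with B show ?thesis
    unfolding semigroup_rank_def
    using card_generating_set_ge card_ret by (intro Least_equality) auto
qed

end
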